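(* Let $X$ be a set. For all $\alpha,\beta\in\mathcal{B}_X$, there exists $\gamma\in\mathcal{B}_X$ such that $\alpha\subseteq\gamma\leq\beta$ if and only if $\alpha\omega\alpha\subseteq\beta\omega\beta$.
   Context: $\mathcal{B}_X$ is the semigroup of all binary relations on $X$ (subsets of $X\times X$) under composition, written as juxtaposition: $(x,y)\in\alpha\beta$ iff there is $z\in X$ with $(x,z)\in\alpha$ and $(z,y)\in\beta$. $\omega=X\times X$ is the universal relation, and $\subseteq$ is set inclusion of relations. The Mitsch order (natural partial order) $\leq$ on any semigroup $S$ is defined by: $a\leq b$ iff $a=b$ or there are $x,y\in S$ such that $a=ax=bx=yb$; here it is taken in $S=\mathcal{B}_X$. *)

theory Defs
  imports Main
begin

text \<open>Binary relations on the carrier set \<open>X\<close>, which may be empty. Multiplication is the library's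
  \<^term>\<open>(O)\<close>, which composes from left to right: \<open>(x, y) \<in> r O s\<close> iff \<open>(x, z) \<in> r\<close> and
  \<open>(z, y) \<in> s\<close> for some \<open>z\<close>.\<close>

definition binrels :: "'a set \<Rightarrow> 'a rel set" where
  "binrels X = Pow (X \<times> X)"

text \<open>The Mitsch order of the semigroup with carrier \<open>S\<close> and multiplication \<open>mult\<close>, meant for
  \<open>a, b \<in> S\<close>; the witnesses range over \<open>S\<close> itself, with no identity adjoined.\<close>

definition mitsch_le :: "'s set \<Rightarrow> ('s \<Rightarrow> 's \<Rightarrow> 's) \<Rightarrow> 's \<Rightarrow> 's \<Rightarrow> bool" where
  "mitsch_le S mult a b \<longleftrightarrow>
     a = b \<or> (\<exists>x\<in>S. \<exists>y\<in>S. a = mult a x \<and> a = mult b x \<and> a = mult y b)"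

end

(* With \<omega> = X \<times> X, the relation \<beta>\<omega>\<beta> is the rectangle dom \<beta> \<times> ran \<beta>. If \<gamma> = \<beta>x = y\<beta>, then
   \<gamma>\<omega>\<gamma> = \<beta>(x\<omega>y)\<beta> \<subseteq> \<beta>\<omega>\<beta>. Conversely, \<gamma> = \<beta>\<omega>\<beta> lies below \<beta>, with witnesses x = \<omega>\<beta> and y = \<beta>\<omega>,
   and it contains \<alpha> because \<alpha> \<subseteq> \<alpha>\<omega>\<alpha>. *)
theory Submission
  imports Defs
begin

lemma mitsch_le_imp_sandwich_subset:
  assumes "mitsch_le (binrels X) (O) \<gamma> \<beta>"
  shows "\<gamma> O (X \<times> X) O \<gamma> \<subseteq> \<beta> O (X \<times> X) O \<beta>"
  using assms unfolding mitsch_le_def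
proof (elim disjE bexE conjE)
  fix x y
  assume "x \<in> binrels X" "y \<in> binrels X" and \<gamma>: "\<gamma> = \<beta> O x" "\<gamma> = y O \<beta>"
  then have "x O (X \<times> X) O y \<subseteq> X \<times> X"
    by (auto simp: binrels_def)
  then have "\<beta> O (x O (X \<times> X) O y) O \<beta> \<subseteq> \<beta> O (X \<times> X) O \<beta>"
    by (intro relcomp_mono subset_refl)
  \<comment> \<open>The left \<gamma> is factored as \<beta>x and the right one as y\<beta>, so that
    x and y end up next to \<omega>.\<close>
  moreover have "\<gamma> O (X \<times> X) O \<gamma> = (\<beta> O x) O (X \<times> X) O (y O \<beta>)"
    using \<gamma> by metis
  ultimately show ?thesis
    by (simp add: O_assoc)
qed simp

lemma mitsch_le_sandwich:
  assumes "\<beta> \<in> binrels X"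
  shows "mitsch_le (binrels X) (O) (\<beta> O (X \<times> X) O \<beta>) \<beta>"
proof -
  have "(X \<times> X) O \<beta> \<in> binrels X" "\<beta> O (X \<times> X) \<in> binrels X"
    using assms by (auto simp: binrels_def)
  \<comment> \<open>Of the three equations only this one is more than associativity: the last pair
    (w, b) of \<beta> on a path is used twice, with (b, w) \<in> \<omega> in between.\<close>
  moreover have "\<beta> O (X \<times> X) O \<beta> = (\<beta> O (X \<times> X) O \<beta>) O ((X \<times> X) O \<beta>)"
    using assms unfolding binrels_def by blast
  ultimately show ?thesis
    unfolding mitsch_le_def by (metis O_assoc)
qed

text \<open>After a pair (a, b) of \<alpha>, \<omega> leads back from b to a, and the same pair is
  used again.\<close>

lemma subset_sandwich:
  assumes "\<alpha> \<in> binrels X"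
  shows "\<alpha> \<subseteq> \<alpha> O (X \<times> X) O \<alpha>"
  using assms unfolding binrels_def by blast

theorem proposition5p1:
  fixes X :: "'a set" and \<alpha> \<beta> \<omega> :: "'a rel"
  assumes "\<alpha> \<in> binrels X" and "\<beta> \<in> binrels X"
  defines "\<omega> \<equiv> X \<times> X"
  shows "(\<exists>\<gamma>\<in>binrels X. \<alpha> \<subseteq> \<gamma> \<and> mitsch_le (binrels X) (O) \<gamma> \<beta>)
           \<longleftrightarrow> \<alpha> O \<omega> O \<alpha> \<subseteq> \<beta> O \<omega> O \<beta>"
proof
  assume "\<exists>\<gamma>\<in>binrels X. \<alpha> \<subseteq> \<gamma> \<and> mitsch_le (binrels X) (O) \<gamma> \<beta>"
  then obtain \<gamma> where "\<alpha> \<subseteq> \<gamma>" and le: "mitsch_le (binrels X) (O) \<gamma> \<beta>"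
    by blast
  then have "\<alpha> O \<omega> O \<alpha> \<subseteq> \<gamma> O \<omega> O \<gamma>"
    by (intro relcomp_mono subset_refl)
  also have "\<dots> \<subseteq> \<beta> O \<omega> O \<beta>"
    using mitsch_le_imp_sandwich_subset[OF le] by (simp add: \<omega>_def)
  finally show "\<alpha> O \<omega> O \<alpha> \<subseteq> \<beta> O \<omega> O \<beta>" .
next
  assume "\<alpha> O \<omega> O \<alpha> \<subseteq> \<beta> O \<omega> O \<beta>"
  \<comment> \<open>The choice \<gamma> = \<beta>\<omega>\<beta> loses nothing: by the lemmas above,
    it contains every relation on X below \<beta>.\<close>
  then have "\<alpha> \<subseteq> \<beta> O \<omega> O \<beta>"
    using subset_sandwich[OF assms(1)] by (simp add: \<omega>_def)
  moreover have "\<beta> O \<omega> O \<beta> \<in> binrels X"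
    using assms(2) by (auto simp: binrels_def)
  moreover have "mitsch_le (binrels X) (O) (\<beta> O \<omega> O \<beta>) \<beta>"
    using mitsch_le_sandwich[OF assms(2)] by (simp add: \<omega>_def)
  ultimately show "\<exists>\<gamma>\<in>binrels X. \<alpha> \<subseteq> \<gamma> \<and> mitsch_le (binrels X) (O) \<gamma> \<beta>"
    by blast
qed

end
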